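(* Let $\mathcal{V}=\{v_1,\dots,v_{|\mathcal{V}|}\}$ be the sites, $\mathcal{U}=\{u_1,\dots,u_{|\mathcal{U}|}\}$ the UAVs, and let $w$, $\pi_j$, $\hat\theta_j$ ($v_j\in\mathcal{V}$), $\varphi_i$, $\tilde\theta_i$, $v_{b^i}$, $\bm{P}_i=[p^{(i)}_{jk}]$, $\bm{\gamma}_i=[\gamma^{(i)}_j]$ ($u_i\in\mathcal{U}$), $\psi^{(i)}_j$, $\iota^{(i)}_j$, $I^{(i)}_j$, $X_i(t)$, $T^{(i)}_+$ be as in the context, where it is assumed that $\sum_{i=1}^{|\mathcal{U}|}\gamma^{(i)}_j\ge\pi_j$ for all $v_j\in\mathcal{V}$. Sufficient conditions for the two probabilistic constraints below can be expressed through the stationary distributions, the transition matrices and the inspection probabilities of the UAVs, as follows. (a) A sufficient condition for $$\Pr\Big(\sum_{i=1}^{|\mathcal{U}|}\gamma^{(i)}_j I^{(i)}_j\le\pi_j\Big)\le\hat\theta_j\qquad\text{for all } v_j\in\mathcal{V}$$ is $$\sum_{i=1}^{|\mathcal{U}|}\gamma^{(i)}_j\iota^{(i)}_j\ \ge\ \hat\theta_j\pi_j+(1-\hat\theta_j)\sum_{i=1}^{|\mathcal{U}|}\gamma^{(i)}_j\qquad\text{for all } v_j\in\mathcal{V}.$$ (b) A sufficient condition for $$\Pr\Big(\sum_{t=1}^{T^{(i)}_+}w\big(X_i(t),X_i(t+1)\big)+\sum_{t=1}^{T^{(i)}_+}\psi^{(i)}_{X_i(t)}I^{(i)}_{X_i(t)}\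 \ge\ \varphi_i\Big)\le\tilde\theta_i\qquad\text{for all } u_i\in\mathcal{U}$$ is $$\sum_{v_j\in\mathcal{V}}\frac{\gamma^{(i)}_j}{\gamma^{(i)}_{b^i}}\sum_{v_k\in\mathcal{V}}p^{(i)}_{jk}\,w(v_j,v_k)+\sum_{v_j\in\mathcal{V}}\frac{\gamma^{(i)}_j}{\gamma^{(i)}_{b^i}}\,\psi^{(i)}_j\,\iota^{(i)}_j\ \le\ \varphi_i\tilde\theta_i\qquad\text{for all } u_i\in\mathcal{U}.$$
   Context: $\mathcal{V}$ (sites) and $\mathcal{U}$ (UAVs) are finite nonempty sets with $|\mathcal{U}|<|\mathcal{V}|$. The function $w:\mathcal{V}\times\mathcal{V}\to\mathbb{R}^+$ gives the energy $w(v_j,v_k)$ of moving from $v_j$ to $v_k$. For each site $v_j$, $\pi_j>0$ is the required inspection criterion (desired expected number of UAVs inspecting the site per unit time in the steady state) and $\hat\theta_j\in(0,1]$ is a tolerance. For each UAV $u_i$, $v_{b^i}\in\mathcal{V}$ is its base node (with index $b^i$), $\varphi_i>0$ its battery capacity, and $\tilde\theta_i\in(0,1]$ a tolerance. $\psi^{(i)}_j>0$ is the energy that $u_i$ spends when inspecting $v_j$, and $\iota^{(i)}_j\in(0,1]$ is the probability that $u_i$ inspects $v_j$ upon arriving there. The position of UAV $u_i$ is an ergodic Markov chain $X_i(t)$ on $\mathcal{V}$, started at its base, $X_i(0)=v_{b^i}$, with transition matrix $\bm{P}_i=[p^{(i)}_{jk}]$, where $p^{(i)}_{jk}=\Pr(X_i(t+1)=v_k\mid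 X_i(t)=v_j)$. Its unique stationary distribution is $\bm{\gamma}_i=[\gamma^{(i)}_1,\dots,\gamma^{(i)}_{|\mathcal{V}|}]$, a row vector with $\bm{\gamma}_i\bm{P}_i=\bm{\gamma}_i$. $I^{(i)}_j$ is a Bernoulli random variable with $\Pr(I^{(i)}_j=1)=\iota^{(i)}_j$, indicating that $u_i$ inspects $v_j$. Whenever $u_i$ arrives at a site $v_j$, it decides to inspect with probability $\iota^{(i)}_j$ independently of all others; $I^{(i)}_{X_i(t)}$ denotes the inspection indicator of the visit at time $t$, and $\psi^{(i)}_{X_i(t)}$ denotes $\psi^{(i)}_j$ with $v_j=X_i(t)$. The return time of $u_i$ to its base is $T^{(i)}_+=\min\{n\ge1: X_i(n)=v_{b^i}\}$, given $X_i(0)=v_{b^i}$.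
   Formalization: In (a), the conclusion for a site v_j is claimed only if the sum of γ_j^(i) over the UAVs exceeds π_j or θ̂_j=1; if the sum equals π_j and θ̂_j<1, the condition forces all ι_j^(i)=1 and the probability is 1, so the claim as stated fails there. *)

theory Defs
  imports "HOL-Probability.Probability"
begin

(* A row-indexed matrix P :: real ^ 'v ^ 'v has the entry P $ j $ k in row j and column k.
   The library's power ^ on vectors is not the matrix power, so the latter is defined here. *)

primrec matrix_power :: "real ^ 'v ^ 'v \<Rightarrow> nat \<Rightarrow> real ^ 'v ^ 'v" where
  "matrix_power A 0 = mat 1"
| "matrix_power A (Suc n) = matrix_power A n ** A"

definition stochastic_matrix :: "real ^ 'v ^ 'v \<Rightarrow> bool" where
  "stochastic_matrix P \<longleftrightarrow> (\<forall>j k. 0 \<le> P $ j $ k) \<and> (\<forall>j. (\<Sum>k\<in>UNIV. P $ j $ k) = 1)"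

definition irreducible_matrix :: "real ^ 'v ^ 'v \<Rightarrow> bool" where
  "irreducible_matrix P \<longleftrightarrow> (\<forall>j k. \<exists>n. 0 < matrix_power P n $ j $ k)"

definition aperiodic_matrix :: "real ^ 'v ^ 'v \<Rightarrow> bool" where
  "aperiodic_matrix P \<longleftrightarrow> (\<forall>j. Gcd {n. 0 < n \<and> 0 < matrix_power P n $ j $ j} = 1)"

definition ergodic_matrix :: "real ^ 'v ^ 'v \<Rightarrow> bool" where
  "ergodic_matrix P \<longleftrightarrow> stochastic_matrix P \<and> irreducible_matrix P \<and> aperiodic_matrix P"

definition stationary_distribution :: "real ^ 'v \<Rightarrow> real ^ 'v ^ 'v \<Rightarrow> bool" where
  "stationary_distribution \<gamma> P \<longleftrightarrow>
     (\<forall>j. 0 \<le> \<gamma> $ j) \<and> (\<Sum>j\<in>UNIV. \<gamma> $ j) = 1 \<and> \<gamma> v* P = \<gamma>"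

(* The Markov property is only required given histories of positive probability,
   because cond_prob is 0 when the condition has probability 0. *)

definition markov_chain ::
  "'a measure \<Rightarrow> (nat \<Rightarrow> 'a \<Rightarrow> 'v) \<Rightarrow> real ^ 'v ^ 'v \<Rightarrow> 'v \<Rightarrow> bool" where
  "markov_chain M X P b \<longleftrightarrow>
     (\<forall>t. X t \<in> M \<rightarrow>\<^sub>M count_space UNIV) \<and>
     (AE \<omega> in M. X 0 \<omega> = b) \<and>
     (\<forall>n x. 0 < \<P>(\<omega> in M. \<forall>t\<le>n. X t \<omega> = x t) \<longrightarrow>
        \<P>(\<omega> in M. X (Suc n) \<omega> = x (Suc n) \<bar> \<forall>t\<le>n. X t \<omega> = x t) = P $ x n $ x (Suc n))"

(* For an irreducible chain on a finite set started in b the minimum exists almost surely;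
   LEAST is an unspecified number on the null event of no return. *)

definition return_time :: "(nat \<Rightarrow> 'a \<Rightarrow> 'v) \<Rightarrow> 'v \<Rightarrow> 'a \<Rightarrow> nat" where
  "return_time X b \<omega> = (LEAST n. 1 \<le> n \<and> X n \<omega> = b)"

definition independent_bernoulli ::
  "'a measure \<Rightarrow> ('u \<Rightarrow> 'v \<Rightarrow> 'a \<Rightarrow> bool) \<Rightarrow> ('u \<Rightarrow> 'v \<Rightarrow> real) \<Rightarrow> bool" where
  "independent_bernoulli M I \<iota> \<longleftrightarrow>
     prob_space.indep_vars M (\<lambda>_. count_space UNIV) (\<lambda>(i, j). I i j) UNIV \<and>
     (\<forall>i j. distr M (count_space UNIV) (I i j) = measure_pmf (bernoulli_pmf (\<iota> i j)))"

(* J i t is the inspection indicator of the site that i visits at time t. Given the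
   trajectories of all i up to any time n, the indicators of the visits up to time n are
   independent, and a visit to site j leads to an inspection with probability \<iota> i j. *)

definition visit_indicators ::
  "'a measure \<Rightarrow> ('u::finite \<Rightarrow> nat \<Rightarrow> 'a \<Rightarrow> 'v) \<Rightarrow> ('u \<Rightarrow> 'v \<Rightarrow> real) \<Rightarrow>
     ('u \<Rightarrow> nat \<Rightarrow> 'a \<Rightarrow> bool) \<Rightarrow> bool" where
  "visit_indicators M X \<iota> J \<longleftrightarrow>
     (\<forall>i t. J i t \<in> M \<rightarrow>\<^sub>M count_space UNIV) \<and>
     (\<forall>n x d. 0 < \<P>(\<omega> in M. \<forall>i. \<forall>t\<le>n. X i t \<omega> = x i t) \<longrightarrow>
        \<P>(\<omega> in M. (\<forall>i. \<forall>t\<le>n. J i t \<omega> = d i t) \<bar> (\<forall>i. \<forall>t\<le>n. X i t \<omega> = x i t)) =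
        (\<Prod>i\<in>UNIV. \<Prod>t\<le>n. pmf (bernoulli_pmf (\<iota> i (x i t))) (d i t)))"

end

theory Submission
  imports Defs
begin

text \<open>
  Both parts are Markov's inequality. For (a) apply it to the expected inspection rate that is lost
  at a site, $\sum_i \gamma^{(i)}_j (1 - I^{(i)}_j)$. For (b) the cost of a tour is at most
  $\sum_{t \ge 1} 1_{\{T_+ \ge t\}} (w(X(t), X(t+1)) + \psi_{X(t)} I_{X(t)})$; the event $T_+ \ge t$
  depends only on $X(1), \dots, X(t-1)$, so the expectation of this series is
  $\sum_j N_j (\sum_k p_{jk} w(v_j, v_k) + \psi_j \iota_j)$ with
  $N_j = \sum_{t \ge 1} \Pr(T_+ \ge t, X(t) = v_j)$. One only needs $N_j \le \gamma_j / \gamma_b$, and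
  this follows for the partial sums by induction from the recursion
  $N_j = p_{bj} + \sum_{k \ne b} N_k p_{kj}$, which $\gamma_j / \gamma_b$ satisfies too.
\<close>

section \<open>Positivity of stationary distributions\<close>

lemma stationary_distribution_matrix_power:
  assumes "\<gamma> v* P = \<gamma>"
  shows "\<gamma> v* matrix_power P n = \<gamma>"
proof (induction n)
  case (Suc n)
  then show ?case
    using assms by (simp flip: vector_matrix_mul_assoc)
qed simp

lemma matrix_power_nonneg:
  fixes P :: "real ^ 'v::finite ^ 'v"
  assumes "\<And>j k. 0 \<le> P $ j $ k"
  shows "0 \<le> matrix_power P n $ j $ k"
  by (induction n arbitrary: j k)
    (auto simp: mat_def matrix_matrix_mult_def assms intro!: sum_nonneg)

text \<open>Makes the quotients by \<open>\<gamma> $ b\<close> meaningful. If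
  \<open>\<gamma> $ b\<close> were 0, entry \<open>b\<close> of the invariance under
  \<open>matrix_power P n\<close> would be a vanishing sum of nonnegative terms. For each
  \<open>k\<close>, irreducibility gives an \<open>n\<close> for which the factor of
  \<open>\<gamma> $ k\<close> is positive, so all of \<gamma> would vanish, against total mass
  1.\<close>

lemma stationary_distribution_pos:
  fixes P :: "real ^ 'v::finite ^ 'v"
  assumes "stochastic_matrix P" "irreducible_matrix P" "stationary_distribution \<gamma> P"
  shows "0 < \<gamma> $ b"
proof (rule ccontr)
  assume "\<not> 0 < \<gamma> $ b"
  with assms have b: "\<gamma> $ b = 0"
    by (metis less_eq_real_def stationary_distribution_def)
  have "\<gamma> $ k = 0" for k
  proof -
    obtain n where n: "0 < matrix_power P n $ k $ b"
      using assms(2) by (auto simp: irreducible_matrix_def)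
    have "(\<Sum>j\<in>UNIV. \<gamma> $ j * matrix_power P n $ j $ b) = (\<gamma> v* matrix_power P n) $ b"
      by (simp add: vector_matrix_mult_def)
    also have "\<dots> = 0"
      using b assms(3) by (simp add: stationary_distribution_matrix_power stationary_distribution_def)
    finally have "\<gamma> $ k * matrix_power P n $ k $ b = 0"
      using assms by (subst (asm) sum_nonneg_eq_0_iff)
        (auto simp: stationary_distribution_def stochastic_matrix_def intro!: mult_nonneg_nonneg matrix_power_nonneg)
    with n show ?thesis
      by simp
  qed
  then show False
    using assms(3) by (simp add: stationary_distribution_def)
qed

section \<open>Conditioning on finite histories\<close>

lemma (in finite_measure) measure_sum_finite_range:
  assumes "finite S" "\<And>\<omega>. \<omega> \<in> space M \<Longrightarrow> H \<omega> \<in> S"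
    and "\<And>h. h \<in> S \<Longrightarrow> {\<omega> \<in> space M. H \<omega> = h} \<in> sets M"
    and "{\<omega> \<in> space M. B \<omega>} \<in> sets M"
  shows "\<P>(\<omega> in M. B \<omega>) = (\<Sum>h\<in>S. \<P>(\<omega> in M. H \<omega> = h \<and> B \<omega>))"
proof -
  have "{\<omega> \<in> space M. B \<omega>} = (\<Union>h\<in>S. {\<omega> \<in> space M. H \<omega> = h \<and> B \<omega>})"
    using assms(2) by auto
  moreover have "{\<omega> \<in> space M. H \<omega> = h \<and> B \<omega>} \<in> sets M" if "h \<in> S" for h
    using assms(3)[OF that] assms(4) by measurable
  ultimately show ?thesis
    using assms(1) by (simp only:) (rule finite_measure_finite_Union; auto simp: disjoint_family_on_def)
qed

text \<open>If \<open>B\<close> has the same conditional probability \<open>c\<close> on every atom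
  \<open>H \<omega> = h\<close> with \<open>Q h\<close>, it has it on their union. The product form
  avoids dividing by the measure of a null atom.\<close>

lemma (in finite_measure) measure_conj_eq_mult:
  assumes fin: "finite S" and ran: "\<And>\<omega>. \<omega> \<in> space M \<Longrightarrow> H \<omega> \<in> S"
    and meas: "\<And>h. h \<in> S \<Longrightarrow> {\<omega> \<in> space M. H \<omega> = h} \<in> sets M"
    and B: "{\<omega> \<in> space M. B \<omega>} \<in> sets M"
    and eq: "\<And>h. h \<in> S \<Longrightarrow> Q h \<Longrightarrow>
      \<P>(\<omega> in M. H \<omega> = h \<and> B \<omega>) = c * \<P>(\<omega> in M. H \<omega> = h)"
  shows "\<P>(\<omega> in M. Q (H \<omega>) \<and> B \<omega>) = c * \<P>(\<omega> in M. Q (H \<omega>))"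
proof -
  have "{\<omega> \<in> space M. Q (H \<omega>)} = (\<Union>h\<in>{h \<in> S. Q h}. {\<omega> \<in> space M. H \<omega> = h})"
    using ran by auto
  also have "\<dots> \<in> sets M"
    using fin meas by (intro sets.finite_UN) auto
  finally have Q: "{\<omega> \<in> space M. Q (H \<omega>)} \<in> sets M" .
  have "\<P>(\<omega> in M. Q (H \<omega>) \<and> B \<omega>) = (\<Sum>h\<in>S. \<P>(\<omega> in M. H \<omega> = h \<and> Q (H \<omega>) \<and> B \<omega>))"
  proof (rule measure_sum_finite_range[OF fin ran meas])
    show "{\<omega> \<in> space M. Q (H \<omega>) \<and> B \<omega>} \<in> sets M"
      using Q B by measurable
  qed
  also have "\<dots> = (\<Sum>h\<in>S. c * \<P>(\<omega> in M. H \<omega> = h \<and> Q (H \<omega>)))"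
  proof (rule sum.cong)
    fix h
    assume "h \<in> S"
    show "\<P>(\<omega> in M. H \<omega> = h \<and> Q (H \<omega>) \<and> B \<omega>) = c * \<P>(\<omega> in M. H \<omega> = h \<and> Q (H \<omega>))"
    proof (cases "Q h")
      case True
      then have "{\<omega> \<in> space M. H \<omega> = h \<and> Q (H \<omega>) \<and> B \<omega>} = {\<omega> \<in> space M. H \<omega> = h \<and> B \<omega>}"
        and "{\<omega> \<in> space M. H \<omega> = h \<and> Q (H \<omega>)} = {\<omega> \<in> space M. H \<omega> = h}"
        by auto
      then show ?thesis
        using eq[OF \<open>h \<in> S\<close> True] by simp
    next
      case False
      then have "{\<omega> \<in> space M. H \<omega> = h \<and> Q (H \<omega>) \<and> B \<omega>} = {}"
        and "{\<omega> \<in> space M. H \<omega> = h \<and> Q (H \<omega>)} = {}"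
        by auto
      then show ?thesis
        by (simp only: measure_empty mult_zero_right)
    qed
  qed simp
  also have "\<dots> = c * \<P>(\<omega> in M. Q (H \<omega>))"
    by (subst measure_sum_finite_range[OF fin ran meas Q]) (auto simp: sum_distrib_left)
  finally show ?thesis .
qed

text \<open>\<open>markov_chain\<close> speaks of complete histories only; summing over those
  compatible with \<open>Q\<close> extends the Markov property to every event determined by the path
  up to time \<open>n\<close>, which is what the hypothesis on \<open>Q\<close> expresses. On
  histories of probability 0 both sides vanish.\<close>

lemma markov_chain_step:
  fixes P :: "real ^ 'v::finite ^ 'v"
  assumes "prob_space M" and mc: "markov_chain M X P b"
    and Q: "\<And>x y. (\<And>t. t \<le> n \<Longrightarrow> x t = y t) \<Longrightarrow> Q x = Q y"
  shows "\<P>(\<omega> in M. (Q (\<lambda>t. X t \<omega>) \<and> X n \<omega> = j) \<and> X (Suc n) \<omega> = k) =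
    P $ j $ k * \<P>(\<omega> in M. Q (\<lambda>t. X t \<omega>) \<and> X n \<omega> = j)"
proof -
  interpret prob_space M by fact
  have X [measurable]: "X t \<in> M \<rightarrow>\<^sub>M count_space UNIV" for t
    using mc by (auto simp: markov_chain_def)
  \<comment> \<open>Cutting the path down to an extensional function leaves finitely many possible
    histories.\<close>
  define H where "H \<omega> = restrict (\<lambda>t. X t \<omega>) {..n}" for \<omega>
  have Heq: "H \<omega> = h \<longleftrightarrow> (\<forall>t\<le>n. X t \<omega> = h t)" if "h \<in> {..n} \<rightarrow>\<^sub>E UNIV" for h \<omega>
    using that by (auto simp: H_def fun_eq_iff restrict_def PiE_def extensional_def)
  have QH: "Q (\<lambda>t. X t \<omega>) = Q (H \<omega>)" "X n \<omega> = H \<omega> n" for \<omega>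
    by (auto simp: H_def intro!: Q)
  show ?thesis
    unfolding QH
  proof (rule measure_conj_eq_mult[where S = "{..n} \<rightarrow>\<^sub>E UNIV" and Q = "\<lambda>h. Q h \<and> h n = j"])
    fix h :: "nat \<Rightarrow> 'v"
    assume h: "h \<in> {..n} \<rightarrow>\<^sub>E UNIV" and "Q h \<and> h n = j"
    \<comment> \<open>\<open>markov_chain\<close> reads the history and the next state off one
      sequence, so the target \<open>k\<close> is written into position
      \<open>Suc n\<close>.\<close>
    let ?x = "h(Suc n := k)"
    have H: "H \<omega> = h \<longleftrightarrow> (\<forall>t\<le>n. X t \<omega> = ?x t)" for \<omega>
      by (auto simp: Heq[OF h])
    show "\<P>(\<omega> in M. H \<omega> = h \<and> X (Suc n) \<omega> = k) = P $ j $ k * \<P>(\<omega> in M. H \<omega> = h)"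
    proof (cases "\<P>(\<omega> in M. H \<omega> = h) = 0")
      case True
      have "\<P>(\<omega> in M. H \<omega> = h \<and> X (Suc n) \<omega> = k) \<le> \<P>(\<omega> in M. H \<omega> = h)"
        unfolding Heq[OF h] by (intro finite_measure_mono) auto
      with True show ?thesis
        by (simp add: measure_le_0_iff)
    next
      case False
      then have "0 < \<P>(\<omega> in M. \<forall>t\<le>n. X t \<omega> = ?x t)"
        unfolding H by (simp add: zero_less_measure_iff)
      then have "\<P>(\<omega> in M. X (Suc n) \<omega> = ?x (Suc n) \<bar> \<forall>t\<le>n. X t \<omega> = ?x t) =
          P $ ?x n $ ?x (Suc n)"
        using mc unfolding markov_chain_def by blast
      with False \<open>Q h \<and> h n = j\<close> show ?thesis
        unfolding H cond_prob_def by (simp add: field_simps conj_commute)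
    qed
  next
    show "H \<omega> \<in> {..n} \<rightarrow>\<^sub>E UNIV" for \<omega>
      by (simp add: H_def)
  qed (auto simp: Heq finite_PiE)
qed

text \<open>\<open>visit_indicators\<close> prescribes the joint law of all indicators given all
  trajectories. Summing out every indicator except the one of \<open>i\<close> at time
  \<open>n\<close> replaces its Bernoulli factor by total mass 1, and only \<iota> remains.\<close>

lemma visit_indicators_step:
  fixes X :: "'u::finite \<Rightarrow> nat \<Rightarrow> 'a \<Rightarrow> 'v::finite"
  assumes "prob_space M" and vi: "visit_indicators M X \<iota> J"
    and X [measurable]: "\<And>i t. X i t \<in> M \<rightarrow>\<^sub>M count_space UNIV"
    and \<iota>: "\<And>i j. 0 \<le> \<iota> i j \<and> \<iota> i j \<le> 1"
    and Q: "\<And>x y. (\<And>t. t \<le> n \<Longrightarrow> x t = y t) \<Longrightarrow> Q x = Q y"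
  shows "\<P>(\<omega> in M. (Q (\<lambda>t. X i t \<omega>) \<and> X i n \<omega> = j) \<and> J i n \<omega>) =
    \<iota> i j * \<P>(\<omega> in M. Q (\<lambda>t. X i t \<omega>) \<and> X i n \<omega> = j)"
proof -
  interpret prob_space M by fact
  have J [measurable]: "J i t \<in> M \<rightarrow>\<^sub>M count_space UNIV" for i t
    using vi by (auto simp: visit_indicators_def)
  \<comment> \<open>Indexing by pairs of a UAV and a time merges the double product of
    \<open>visit_indicators\<close> into a single one over a finite set.\<close>
  define K :: "('u \<times> nat) set" where "K = UNIV \<times> {..n}"
  have finK: "finite K"
    by (simp add: K_def)
  define H where "H \<omega> = restrict (\<lambda>(i, t). X i t \<omega>) K" for \<omega>
  define D where "D \<omega> = restrict (\<lambda>(i, t). J i t \<omega>) K" for \<omega>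
  have Heq: "H \<omega> = h \<longleftrightarrow> (\<forall>i. \<forall>t\<le>n. X i t \<omega> = h (i, t))" if "h \<in> K \<rightarrow>\<^sub>E UNIV" for h \<omega>
    using that by (auto simp: H_def K_def fun_eq_iff restrict_def PiE_def extensional_def)
  have Deq: "D \<omega> = d \<longleftrightarrow> (\<forall>i. \<forall>t\<le>n. J i t \<omega> = d (i, t))" if "d \<in> K \<rightarrow>\<^sub>E UNIV" for d \<omega>
    using that by (auto simp: D_def K_def fun_eq_iff restrict_def PiE_def extensional_def)
  have QH: "Q (\<lambda>t. X i t \<omega>) = Q (\<lambda>t. H \<omega> (i, t))" "X i n \<omega> = H \<omega> (i, n)" for \<omega>
    by (auto simp: H_def K_def intro!: Q)
  show ?thesis
    unfolding QH
  proof (rule measure_conj_eq_mult[where S = "K \<rightarrow>\<^sub>E UNIV"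
        and Q = "\<lambda>h. Q (\<lambda>t. h (i, t)) \<and> h (i, n) = j"])
    fix h :: "'u \<times> nat \<Rightarrow> 'v"
    assume h: "h \<in> K \<rightarrow>\<^sub>E UNIV" and hj: "Q (\<lambda>t. h (i, t)) \<and> h (i, n) = j"
    let ?f = "\<lambda>k. pmf (bernoulli_pmf (\<iota> (fst k) (h k)))"
    \<comment> \<open>Coordinate \<open>(i, n)\<close> is pinned to \<open>True\<close> and all
      others are free: \<open>PiE K ?E\<close> consists of the indicator patterns compatible with
      \<open>J i n\<close>. Every other pattern contributes an empty event.\<close>
    let ?E = "\<lambda>k. if k = (i, n) then {True} else UNIV"
    have d: "\<P>(\<omega> in M. D \<omega> = d \<and> H \<omega> = h) = \<P>(\<omega> in M. H \<omega> = h) * (\<Prod>k\<in>K. ?f k (d k))"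
      if "d \<in> K \<rightarrow>\<^sub>E UNIV" for d
    proof (cases "\<P>(\<omega> in M. H \<omega> = h) = 0")
      case True
      have "\<P>(\<omega> in M. D \<omega> = d \<and> H \<omega> = h) \<le> \<P>(\<omega> in M. H \<omega> = h)"
        unfolding Heq[OF h] by (intro finite_measure_mono) auto
      with True show ?thesis
        by (simp add: measure_le_0_iff)
    next
      case False
      let ?x = "\<lambda>i t. h (i, t)" and ?d = "\<lambda>i t. d (i, t)"
      have "0 < \<P>(\<omega> in M. \<forall>i. \<forall>t\<le>n. X i t \<omega> = ?x i t)"
        using False unfolding Heq[OF h] by (simp add: zero_less_measure_iff)
      then have "\<P>(\<omega> in M. (\<forall>i. \<forall>t\<le>n. J i t \<omega> = ?d i t) \<bar> (\<forall>i. \<forall>t\<le>n. X i t \<omega> = ?x i t)) =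
        (\<Prod>i\<in>UNIV. \<Prod>t\<le>n. pmf (bernoulli_pmf (\<iota> i (?x i t))) (?d i t))"
        using vi[unfolded visit_indicators_def, THEN conjunct2, rule_format, of n ?x ?d] by blast
      also have "\<dots> = (\<Prod>k\<in>K. ?f k (d k))"
        by (simp add: K_def prod.cartesian_product case_prod_beta)
      finally show ?thesis
        using False unfolding Heq[OF h] Deq[OF that] cond_prob_def by (simp add: field_simps)
    qed
    have "\<P>(\<omega> in M. H \<omega> = h \<and> J i n \<omega>) =
        (\<Sum>d\<in>K \<rightarrow>\<^sub>E UNIV. \<P>(\<omega> in M. D \<omega> = d \<and> H \<omega> = h \<and> J i n \<omega>))"
    proof (rule measure_sum_finite_range)
      show "D \<omega> \<in> K \<rightarrow>\<^sub>E UNIV" for \<omega>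
        by (simp add: D_def)
    qed (auto simp: Heq[OF h] Deq finite_PiE finK)
    also have "\<dots> = (\<Sum>d\<in>PiE K ?E. \<P>(\<omega> in M. D \<omega> = d \<and> H \<omega> = h))"
    proof (rule sum.mono_neutral_cong_right)
      show "PiE K ?E \<subseteq> K \<rightarrow>\<^sub>E UNIV"
        by (auto simp: PiE_def)
    next
      have J: "J i n \<omega> = d (i, n)" if "D \<omega> = d" for \<omega> d
        using that by (auto simp: D_def K_def)
      show "\<forall>d\<in>(K \<rightarrow>\<^sub>E UNIV) - PiE K ?E. \<P>(\<omega> in M. D \<omega> = d \<and> H \<omega> = h \<and> J i n \<omega>) = 0"
      proof
        fix d
        assume "d \<in> (K \<rightarrow>\<^sub>E UNIV) - PiE K ?E"
        then have "\<not> d (i, n)"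
          by (auto simp: PiE_def Pi_def split: if_splits)
        then have "{\<omega> \<in> space M. D \<omega> = d \<and> H \<omega> = h \<and> J i n \<omega>} = {}"
          using J by auto
        then show "\<P>(\<omega> in M. D \<omega> = d \<and> H \<omega> = h \<and> J i n \<omega>) = 0"
          by (simp only: measure_empty)
      qed
      fix d
      assume "d \<in> PiE K ?E"
      then have "d (i, n)"
        using PiE_mem[of d K ?E "(i, n)"] by (auto simp: K_def)
      then have "{\<omega> \<in> space M. D \<omega> = d \<and> H \<omega> = h \<and> J i n \<omega>} = {\<omega> \<in> space M. D \<omega> = d \<and> H \<omega> = h}"
        using J by auto
      then show "\<P>(\<omega> in M. D \<omega> = d \<and> H \<omega> = h \<and> J i n \<omega>) = \<P>(\<omega> in M. D \<omega> = d \<and> H \<omega> = h)"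
        by (simp only:)
    qed (simp add: finite_PiE finK)
    also have "\<dots> = (\<Sum>d\<in>PiE K ?E. \<P>(\<omega> in M. H \<omega> = h) * (\<Prod>k\<in>K. ?f k (d k)))"
      by (intro sum.cong d) (auto simp: PiE_def)
    \<comment> \<open>A sum over all patterns of a product over coordinates is the product of the
      coordinatewise sums.\<close>
    also have "\<dots> = \<P>(\<omega> in M. H \<omega> = h) * (\<Prod>k\<in>K. \<Sum>a\<in>?E k. ?f k a)"
      unfolding sum_distrib_left[symmetric] using finK
      by (subst prod_sum_PiE) auto
    also have "(\<Prod>k\<in>K. \<Sum>a\<in>?E k. ?f k a) = (\<Prod>k\<in>K. if k = (i, n) then \<iota> i j else 1)"
      using hj \<iota> by (intro prod.cong) (auto simp: UNIV_bool)
    also have "\<dots> = \<iota> i j"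
      using finK by (simp add: prod.delta K_def)
    finally show "\<P>(\<omega> in M. H \<omega> = h \<and> J i n \<omega>) = \<iota> i j * \<P>(\<omega> in M. H \<omega> = h)"
      by simp
  next
    show "H \<omega> \<in> K \<rightarrow>\<^sub>E UNIV" for \<omega>
      by (simp add: H_def)
  qed (auto simp: Heq finite_PiE finK)
qed

section \<open>Visits before the first return\<close>

text \<open>Encodes that the return time is at least \<open>n\<close>. It is a predicate on paths,
  so that it can serve as \<open>Q\<close> in the step lemmas; time 0 is left out because the start
  at the base is no return.\<close>

definition no_return_before :: "'v \<Rightarrow> nat \<Rightarrow> (nat \<Rightarrow> 'v) \<Rightarrow> bool" where
  "no_return_before b n x \<longleftrightarrow> (\<forall>t\<in>{1..<n}. x t \<noteq> b)"

lemma no_return_before_cong: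
  "(\<And>t. t \<le> n \<Longrightarrow> x t = y t) \<Longrightarrow> no_return_before b n x = no_return_before b n y"
  by (auto simp: no_return_before_def)

text \<open>Only \<open>not_less_Least\<close> is used, so this also holds for paths that never
  return, whatever value \<open>LEAST\<close> has there.\<close>

lemma no_return_before_return_time:
  "t \<le> return_time X b \<omega> \<Longrightarrow> no_return_before b t (\<lambda>t. X t \<omega>)"
  unfolding no_return_before_def return_time_def
  by (auto dest!: less_le_trans[THEN not_less_Least, rotated])

text \<open>The partial sums obey a recursion that is monotone because \<open>P\<close> is
  nonnegative and that has the quotient \<open>\<gamma> $ j / \<gamma> $ b\<close> as a fixed point.
  They start at 0, below this fixed point, and hence stay below it.\<close>

lemma expected_visits_le:
  fixes P :: "real ^ 'v::finite ^ 'v"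
  assumes "prob_space M" and mc: "markov_chain M X P b"
    and P: "stochastic_matrix P" "irreducible_matrix P" and \<gamma>: "stationary_distribution \<gamma> P"
  shows "(\<Sum>t<n. \<P>(\<omega> in M. no_return_before b (Suc t) (\<lambda>t. X t \<omega>) \<and> X (Suc t) \<omega> = j)) \<le>
    \<gamma> $ j / \<gamma> $ b"
proof -
  interpret prob_space M by fact
  have X [measurable]: "X t \<in> M \<rightarrow>\<^sub>M count_space UNIV" for t
    using mc by (auto simp: markov_chain_def)
  define u where "u t j = \<P>(\<omega> in M. no_return_before b (Suc t) (\<lambda>t. X t \<omega>) \<and> X (Suc t) \<omega> = j)"
    for t j
  have Pnn: "0 \<le> P $ j $ k" for j k
    using P by (auto simp: stochastic_matrix_def)
  have \<gamma>b: "0 < \<gamma> $ b"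
    using P \<gamma> by (rule stationary_distribution_pos)
  have u0: "u 0 j = P $ b $ j" for j
  proof -
    have b: "AE \<omega> in M. X 0 \<omega> = b"
      using mc by (simp add: markov_chain_def)
    \<comment> \<open>No time is constrained by \<open>no_return_before b (Suc 0)\<close>, and the
      start in \<open>b\<close> is almost sure, so the step lemma applies at time 0 with the trivial
      event \<open>True\<close>.\<close>
    have "u 0 j = \<P>(\<omega> in M. (True \<and> X 0 \<omega> = b) \<and> X (Suc 0) \<omega> = j)"
      unfolding u_def no_return_before_def
      using b by (intro measure_eq_AE) auto
    also have "\<dots> = P $ b $ j * \<P>(\<omega> in M. True \<and> X 0 \<omega> = b)"
      using assms(1) mc by (rule markov_chain_step) simp
    also have "\<P>(\<omega> in M. True \<and> X 0 \<omega> = b) = 1"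
      using b by (simp add: prob_Collect_eq_1)
    finally show ?thesis
      by simp
  qed
  \<comment> \<open>Split by the position at time \<open>Suc t\<close>. The base drops out, since
    being there would already be a return.\<close>
  have uSuc: "u (Suc t) j = (\<Sum>k\<in>UNIV - {b}. P $ k $ j * u t k)" for t j
  proof -
    have "u (Suc t) j = (\<Sum>k\<in>UNIV. \<P>(\<omega> in M. X (Suc t) \<omega> = k \<and>
        no_return_before b (Suc (Suc t)) (\<lambda>t. X t \<omega>) \<and> X (Suc (Suc t)) \<omega> = j))"
      unfolding u_def no_return_before_def by (rule measure_sum_finite_range) auto
    also have "\<dots> = (\<Sum>k\<in>UNIV - {b}. P $ k $ j * u t k)"
    proof (rule sum.mono_neutral_cong_right)
      fix k
      assume "k \<in> UNIV - {b}"
      then have "\<P>(\<omega> in M. X (Suc t) \<omega> = k \<and> no_return_before b (Suc (Suc t)) (\<lambda>t. X t \<omega>) \<and>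
          X (Suc (Suc t)) \<omega> = j) =
        \<P>(\<omega> in M. (no_return_before b (Suc t) (\<lambda>t. X t \<omega>) \<and> X (Suc t) \<omega> = k) \<and> X (Suc (Suc t)) \<omega> = j)"
        by (intro arg_cong[where f = prob]) (auto simp: no_return_before_def less_Suc_eq)
      also have "\<dots> = P $ k $ j * u t k"
        unfolding u_def using assms(1) mc no_return_before_cong by (rule markov_chain_step)
      finally show "\<P>(\<omega> in M. X (Suc t) \<omega> = k \<and> no_return_before b (Suc (Suc t)) (\<lambda>t. X t \<omega>) \<and>
          X (Suc (Suc t)) \<omega> = j) = P $ k $ j * u t k" .
    next
      have "{\<omega> \<in> space M. X (Suc t) \<omega> = b \<and> no_return_before b (Suc (Suc t)) (\<lambda>t. X t \<omega>) \<and>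
          X (Suc (Suc t)) \<omega> = j} = {}"
        by (auto simp: no_return_before_def)
      then have "\<P>(\<omega> in M. X (Suc t) \<omega> = b \<and>
          no_return_before b (Suc (Suc t)) (\<lambda>t. X t \<omega>) \<and> X (Suc (Suc t)) \<omega> = j) = 0"
        by (simp only: measure_empty)
      then show "\<forall>k\<in>UNIV - (UNIV - {b}). \<P>(\<omega> in M. X (Suc t) \<omega> = k \<and>
          no_return_before b (Suc (Suc t)) (\<lambda>t. X t \<omega>) \<and> X (Suc (Suc t)) \<omega> = j) = 0"
        by simp
    qed auto
    finally show ?thesis .
  qed
  have "(\<Sum>t<n. u t j) \<le> \<gamma> $ j / \<gamma> $ b" for n j
  proof (induction n arbitrary: j)
    case 0
    show ?case
      using \<gamma> by (simp add: stationary_distribution_def)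
  next
    case (Suc n)
    \<comment> \<open>Split off the first time; by \<open>uSuc\<close> the later ones form the
      recursion applied to the partial sums up to \<open>n\<close>.\<close>
    have "(\<Sum>t<Suc n. u t j) = P $ b $ j + (\<Sum>k\<in>UNIV - {b}. P $ k $ j * (\<Sum>t<n. u t k))"
      unfolding sum.lessThan_Suc_shift u0 uSuc sum_distrib_left
      by (subst sum.swap) simp
    also have "\<dots> \<le> P $ b $ j + (\<Sum>k\<in>UNIV - {b}. P $ k $ j * (\<gamma> $ k / \<gamma> $ b))"
      by (intro add_left_mono sum_mono mult_left_mono Suc Pnn)
    \<comment> \<open>The isolated \<open>P $ b $ j\<close> is the missing summand
      \<open>k = b\<close>, because \<open>\<gamma> $ b / \<gamma> $ b = 1\<close>.\<close>
    also have "\<dots> = (\<Sum>k\<in>UNIV. P $ k $ j * (\<gamma> $ k / \<gamma> $ b))"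
      using \<gamma>b by (subst (2) sum.remove[of _ b]) auto
    also have "\<dots> = (\<gamma> v* P) $ j / \<gamma> $ b"
      by (simp add: vector_matrix_mult_def sum_divide_distrib mult.commute)
    also have "\<dots> = \<gamma> $ j / \<gamma> $ b"
      using \<gamma> by (simp add: stationary_distribution_def)
    finally show ?case .
  qed
  then show ?thesis
    by (simp add: u_def)
qed

section \<open>The energy constraint\<close>

text \<open>The random number of summands is traded for indicators inside an infinite series. Its
  terms are nonnegative, so it can be integrated term by term in \<open>ennreal\<close>; that the
  integral is finite comes out of the bound itself.\<close>

lemma tour_cost_tail_bound:
  fixes w :: "'v::finite \<Rightarrow> 'v \<Rightarrow> real" and X :: "'u::finite \<Rightarrow> nat \<Rightarrow> 'a \<Rightarrow> 'v"
  assumes "prob_space M"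
    and w: "\<And>j k. 0 \<le> w j k" and \<psi>: "\<And>j. 0 \<le> \<psi> j" and "0 < \<phi>"
    and \<iota>: "\<And>i j. 0 \<le> \<iota> i j \<and> \<iota> i j \<le> 1"
    and P: "stochastic_matrix P" "irreducible_matrix P" and \<gamma>: "stationary_distribution \<gamma> P"
    and mc: "markov_chain M (X i) P b"
    and X [measurable]: "\<And>i t. X i t \<in> M \<rightarrow>\<^sub>M count_space UNIV"
    and vi: "visit_indicators M X \<iota> J"
  shows "\<P>(\<omega> in M. (\<Sum>t = 1..return_time (X i) b \<omega>. w (X i t \<omega>) (X i (t + 1) \<omega>)) +
      (\<Sum>t = 1..return_time (X i) b \<omega>. \<psi> (X i t \<omega>) * of_bool (J i t \<omega>)) \<ge> \<phi>) \<le>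
    ((\<Sum>j\<in>UNIV. \<gamma> $ j / \<gamma> $ b * (\<Sum>k\<in>UNIV. P $ j $ k * w j k)) +
      (\<Sum>j\<in>UNIV. \<gamma> $ j / \<gamma> $ b * \<psi> j * \<iota> i j)) / \<phi>" (is "?lhs \<le> ?e / \<phi>")
proof -
  interpret prob_space M by fact
  have J [measurable]: "J i t \<in> M \<rightarrow>\<^sub>M count_space UNIV" for i t
    using vi by (auto simp: visit_indicators_def)
  let ?N = "\<lambda>t \<omega>. no_return_before b t (\<lambda>t. X i t \<omega>)"
  define u where "u t j = \<P>(\<omega> in M. ?N t \<omega> \<and> X i t \<omega> = j)" for t j
  \<comment> \<open>The expected cost of one visit to \<open>j\<close>: the move that follows and
    the possible inspection.\<close>
  define c where "c j = (\<Sum>k\<in>UNIV. P $ j $ k * w j k) + \<psi> j * \<iota> i j" for j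
  have c: "0 \<le> c j" for j
    unfolding c_def using w \<psi> \<iota> P
    by (intro add_nonneg_nonneg sum_nonneg mult_nonneg_nonneg) (auto simp: stochastic_matrix_def)
  define f where "f t \<omega> = of_bool (?N t \<omega>) *
    (w (X i t \<omega>) (X i (Suc t) \<omega>) + \<psi> (X i t \<omega>) * of_bool (J i t \<omega>))" for t \<omega>
  have f0: "0 \<le> f t \<omega>" for t \<omega>
    using w \<psi> by (simp add: f_def)
  \<comment> \<open>On these events the cost at time \<open>t\<close> has constant coefficients, and
    the two step lemmas give their probabilities.\<close>
  define A where "A t j k = {\<omega> \<in> space M. (?N t \<omega> \<and> X i t \<omega> = j) \<and> X i (Suc t) \<omega> = k}" for t j k
  define B where "B t j = {\<omega> \<in> space M. (?N t \<omega> \<and> X i t \<omega> = j) \<and> J i t \<omega>}" for t j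
  have A [measurable]: "A t j k \<in> sets M" and B [measurable]: "B t j \<in> sets M" for t j k
    unfolding A_def B_def no_return_before_def by measurable
  have pA: "prob (A t j k) = P $ j $ k * u t j" for t j k
    unfolding A_def u_def using assms(1) mc no_return_before_cong by (rule markov_chain_step)
  have pB: "prob (B t j) = \<iota> i j * u t j" for t j
    unfolding B_def u_def using assms(1) vi X \<iota> no_return_before_cong by (rule visit_indicators_step)
  \<comment> \<open>For a given outcome only the actual position \<open>j\<close> and the actual
    successor \<open>k\<close> contribute. This finite form yields both the integral and the
    measurability of \<open>f t\<close>.\<close>
  have f_eq: "f t \<omega> = (\<Sum>j\<in>UNIV. (\<Sum>k\<in>UNIV. w j k * indicator (A t j k) \<omega>) + \<psi> j * indicator (B t j) \<omega>)"
    if "\<omega> \<in> space M" for t \<omega>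
  proof -
    have "(\<Sum>k\<in>UNIV. w j k * indicator (A t j k) \<omega>) + \<psi> j * indicator (B t j) \<omega> =
      (if X i t \<omega> = j then f t \<omega> else 0)" for j
    proof -
      have "(\<Sum>k\<in>UNIV. w j k * indicator (A t j k) \<omega>) =
        (\<Sum>k\<in>UNIV. if X i (Suc t) \<omega> = k then of_bool (?N t \<omega> \<and> X i t \<omega> = j) * w j k else 0)"
        using that by (intro sum.cong) (auto simp: A_def)
      then show ?thesis
        using that by (auto simp: f_def B_def)
    qed
    then show ?thesis
      by simp
  qed
  have Ef: "(\<integral>\<^sup>+\<omega>. ennreal (f t \<omega>) \<partial>M) = ennreal (\<Sum>j\<in>UNIV. u t j * c j)" for t
  proof -
    let ?g = "\<lambda>\<omega>. \<Sum>j\<in>UNIV. (\<Sum>k\<in>UNIV. w j k * indicator (A t j k) \<omega>) + \<psi> j * indicator (B t j) \<omega>"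
    have int: "has_bochner_integral M ?g
        (\<Sum>j\<in>UNIV. (\<Sum>k\<in>UNIV. w j k * prob (A t j k)) + \<psi> j * prob (B t j))"
      by (intro has_bochner_integral_sum has_bochner_integral_add has_bochner_integral_mult_right
          has_bochner_integral_real_indicator A B) (auto simp: emeasure_eq_measure)
    have "(\<integral>\<^sup>+\<omega>. ennreal (f t \<omega>) \<partial>M) = (\<integral>\<^sup>+\<omega>. ennreal (?g \<omega>) \<partial>M)"
      by (intro nn_integral_cong) (simp add: f_eq)
    also have "\<dots> = ennreal (\<integral>\<omega>. ?g \<omega> \<partial>M)"
      using w \<psi> integrable.intros[OF int]
      by (intro nn_integral_eq_integral AE_I2 sum_nonneg add_nonneg_nonneg mult_nonneg_nonneg) auto
    also have "(\<integral>\<omega>. ?g \<omega> \<partial>M) = (\<Sum>j\<in>UNIV. (\<Sum>k\<in>UNIV. w j k * prob (A t j k)) + \<psi> j * prob (B t j))"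
      using int by (rule has_bochner_integral_integral_eq)
    also have "\<dots> = (\<Sum>j\<in>UNIV. u t j * c j)"
      by (simp add: pA pB c_def algebra_simps sum_distrib_left)
    finally show ?thesis .
  qed
  have f_meas [measurable]: "f t \<in> borel_measurable M" for t
    using f_eq by (subst measurable_cong) (assumption, measurable)
  \<comment> \<open>The shift by \<open>Suc\<close> makes the series start at time 1, as the tour
    sums do.\<close>
  define Z where "Z \<omega> = (\<Sum>t. ennreal (f (Suc t) \<omega>))" for \<omega>
  have Z_meas [measurable]: "Z \<in> borel_measurable M"
    unfolding Z_def by measurable
  have e0: "0 \<le> ?e"
    using P \<gamma> w \<psi> \<iota> by (intro add_nonneg_nonneg sum_nonneg mult_nonneg_nonneg divide_nonneg_nonneg)
      (auto simp: stationary_distribution_def stochastic_matrix_def)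
  have "(\<integral>\<^sup>+\<omega>. Z \<omega> \<partial>M) = (\<Sum>t. ennreal (\<Sum>j\<in>UNIV. u (Suc t) j * c j))"
    unfolding Z_def by (simp add: nn_integral_suminf Ef)
  also have "\<dots> \<le> ennreal ?e"
  proof (rule suminf_le_const)
    fix n
    have "(\<Sum>t<n. \<Sum>j\<in>UNIV. u (Suc t) j * c j) = (\<Sum>j\<in>UNIV. (\<Sum>t<n. u (Suc t) j) * c j)"
      unfolding sum_distrib_right by (rule sum.swap)
    also have "\<dots> \<le> (\<Sum>j\<in>UNIV. \<gamma> $ j / \<gamma> $ b * c j)"
      unfolding u_def using assms(1) mc P \<gamma>
      by (intro sum_mono mult_right_mono c expected_visits_le)
    also have "\<dots> = ?e"
      by (simp add: c_def algebra_simps sum.distrib)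
    finally show "(\<Sum>t<n. ennreal (\<Sum>j\<in>UNIV. u (Suc t) j * c j)) \<le> ennreal ?e"
      using c by (subst sum_ennreal) (auto simp: u_def intro!: sum_nonneg ennreal_leI)
  qed simp
  finally have EZ: "(\<integral>\<^sup>+\<omega>. Z \<omega> \<partial>M) \<le> ennreal ?e" .
  \<comment> \<open>This also covers the paths that never return, where the number of summands on the left is
    unspecified: on them every term of \<open>Z\<close> is present.\<close>
  have le: "ennreal ((\<Sum>t = 1..return_time (X i) b \<omega>. w (X i t \<omega>) (X i (t + 1) \<omega>)) +
      (\<Sum>t = 1..return_time (X i) b \<omega>. \<psi> (X i t \<omega>) * of_bool (J i t \<omega>))) \<le> Z \<omega>" for \<omega>
  proof -
    let ?T = "return_time (X i) b \<omega>"
    have "(\<Sum>t = 1..?T. w (X i t \<omega>) (X i (t + 1) \<omega>)) + (\<Sum>t = 1..?T. \<psi> (X i t \<omega>) * of_bool (J i t \<omega>)) =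
      (\<Sum>t = 1..?T. f t \<omega>)"
      unfolding sum.distrib[symmetric]
      by (intro sum.cong) (auto simp: f_def no_return_before_return_time)
    also have "\<dots> = (\<Sum>t<?T. f (Suc t) \<omega>)"
      by (simp add: sum.atLeast1_atMost_eq)
    also have "ennreal \<dots> = (\<Sum>t<?T. ennreal (f (Suc t) \<omega>))"
      using f0 by (simp add: sum_ennreal)
    also have "\<dots> \<le> Z \<omega>"
      unfolding Z_def by (rule sum_le_suminf) auto
    finally show ?thesis .
  qed
  \<comment> \<open>\<open>finite_measure_mono\<close> asks for measurability of the larger event
    only, and that event has the shape required by
    \<open>nn_integral_Markov_inequality\<close>.\<close>
  have "?lhs \<le> \<P>(\<omega> in M. 1 \<le> ennreal (1 / \<phi>) * Z \<omega>)"
  proof (rule finite_measure_mono)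
    show "{\<omega> \<in> space M. (\<Sum>t = 1..return_time (X i) b \<omega>. w (X i t \<omega>) (X i (t + 1) \<omega>)) +
        (\<Sum>t = 1..return_time (X i) b \<omega>. \<psi> (X i t \<omega>) * of_bool (J i t \<omega>)) \<ge> \<phi>} \<subseteq>
      {\<omega> \<in> space M. 1 \<le> ennreal (1 / \<phi>) * Z \<omega>}"
    proof safe
      fix \<omega>
      assume "\<phi> \<le> (\<Sum>t = 1..return_time (X i) b \<omega>. w (X i t \<omega>) (X i (t + 1) \<omega>)) +
        (\<Sum>t = 1..return_time (X i) b \<omega>. \<psi> (X i t \<omega>) * of_bool (J i t \<omega>))"
      then have "ennreal \<phi> \<le> Z \<omega>"
        using le[of \<omega>] by (meson ennreal_leI order_trans)
      then have "ennreal (1 / \<phi>) * ennreal \<phi> \<le> ennreal (1 / \<phi>) * Z \<omega>"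
        by (intro mult_left_mono) auto
      then show "1 \<le> ennreal (1 / \<phi>) * Z \<omega>"
        using \<open>0 < \<phi>\<close> by (simp add: ennreal_mult[symmetric])
    qed
  qed measurable
  also have "\<dots> \<le> ?e / \<phi>"
  proof -
    have "emeasure M ({\<omega> \<in> space M. 1 \<le> ennreal (1 / \<phi>) * Z \<omega>}) \<le> ennreal (1 / \<phi>) * (\<integral>\<^sup>+\<omega>. Z \<omega> * indicator (space M) \<omega> \<partial>M)"
      by (rule nn_integral_Markov_inequality) auto
    also have "(\<integral>\<^sup>+\<omega>. Z \<omega> * indicator (space M) \<omega> \<partial>M) = (\<integral>\<^sup>+\<omega>. Z \<omega> \<partial>M)"
      by (intro nn_integral_cong) auto
    also have "ennreal (1 / \<phi>) * (\<integral>\<^sup>+\<omega>. Z \<omega> \<partial>M) \<le> ennreal (1 / \<phi>) * ennreal ?e"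
      using EZ by (rule mult_left_mono) simp
    also have "\<dots> = ennreal (?e / \<phi>)"
      using \<open>0 < \<phi>\<close> e0 by (simp add: ennreal_mult[symmetric])
    finally show ?thesis
      using \<open>0 < \<phi>\<close> e0 by (simp add: emeasure_eq_measure)
  qed
  finally show ?thesis .
qed

section \<open>The inspection constraint\<close>

text \<open>The event says that the lost rate \<open>Y\<close> is at least \<open>?S - p\<close>.
  Markov's inequality bounds its probability by the mean of \<open>Y\<close> over
  \<open>?S - p\<close>, and \<open>le\<close> rearranges to exactly the claim that this quotient is
  at most \<theta>. The strict inequality makes the divisor positive.\<close>

lemma inspection_rate_tail_bound:
  fixes g :: "'u::finite \<Rightarrow> real"
  assumes "prob_space M"
    and I [measurable]: "\<And>i. I i \<in> M \<rightarrow>\<^sub>M count_space UNIV"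
    and I_distr: "\<And>i. distr M (count_space UNIV) (I i) = measure_pmf (bernoulli_pmf (\<iota> i))"
    and \<iota>: "\<And>i. 0 \<le> \<iota> i \<and> \<iota> i \<le> 1" and g: "\<And>i. 0 \<le> g i" and "p < (\<Sum>i\<in>UNIV. g i)"
    and le: "\<theta> * p + (1 - \<theta>) * (\<Sum>i\<in>UNIV. g i) \<le> (\<Sum>i\<in>UNIV. g i * \<iota> i)"
  shows "\<P>(\<omega> in M. (\<Sum>i\<in>UNIV. g i * of_bool (I i \<omega>)) \<le> p) \<le> \<theta>"
proof -
  interpret prob_space M by fact
  let ?S = "\<Sum>i\<in>UNIV. g i"
  define F where "F i = {\<omega> \<in> space M. I i \<omega>}" for i
  have F [measurable]: "F i \<in> sets M" for i
    unfolding F_def by measurable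
  have pF: "prob (F i) = \<iota> i" for i
  proof -
    have "prob (F i) = measure (distr M (count_space UNIV) (I i)) {True}"
      by (subst measure_distr) (auto simp: F_def intro!: arg_cong[where f = prob])
    also have "\<dots> = \<iota> i"
      unfolding I_distr using \<iota>[of i] by (simp add: measure_pmf_single)
    finally show ?thesis .
  qed
  define Y where "Y \<omega> = ?S - (\<Sum>i\<in>UNIV. g i * indicator (F i) \<omega>)" for \<omega>
  have int: "has_bochner_integral M Y (?S - (\<Sum>i\<in>UNIV. g i * \<iota> i))"
    unfolding Y_def pF[symmetric]
  proof (rule has_bochner_integral_diff)
    show "has_bochner_integral M (\<lambda>_. ?S) ?S"
      by (simp add: has_bochner_integral_iff prob_space)
    show "has_bochner_integral M (\<lambda>\<omega>. \<Sum>i\<in>UNIV. g i * indicator (F i) \<omega>) (\<Sum>i\<in>UNIV. g i * prob (F i))"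
      by (intro has_bochner_integral_sum has_bochner_integral_mult_right
          has_bochner_integral_real_indicator F) (simp add: emeasure_eq_measure)
  qed
  \<comment> \<open>Each indicator is at most 1 and the weights are nonnegative, so the achieved
    rate never exceeds \<open>?S\<close>.\<close>
  have "0 \<le> Y \<omega>" for \<omega>
    unfolding Y_def diff_ge_0_iff_ge using g by (intro sum_mono mult_right_le_one_le) auto
  then have "\<P>(\<omega> in M. ?S - p \<le> Y \<omega>) \<le> (\<integral>\<omega>. Y \<omega> \<partial>M) / (?S - p)"
    using \<open>p < ?S\<close> integrable.intros[OF int]
    by (intro integral_Markov_inequality_measure[where A = "{}"]) auto
  also have "(\<integral>\<omega>. Y \<omega> \<partial>M) = ?S - (\<Sum>i\<in>UNIV. g i * \<iota> i)"
    using int by (rule has_bochner_integral_integral_eq)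
  also have "\<dots> / (?S - p) \<le> \<theta>"
    using le \<open>p < ?S\<close> by (simp add: divide_le_eq algebra_simps)
  also have "\<P>(\<omega> in M. ?S - p \<le> Y \<omega>) = \<P>(\<omega> in M. (\<Sum>i\<in>UNIV. g i * of_bool (I i \<omega>)) \<le> p)"
    by (intro arg_cong[where f = prob] Collect_cong conj_cong refl)
      (auto simp: Y_def F_def indicator_def of_bool_def)
  finally show ?thesis .
qed

section \<open>Both sufficient conditions\<close>

text \<open>The premise of (a) on equality excludes a genuine failure: if the stationary rates at
  \<open>j\<close> sum to exactly \<open>\<pi> j\<close>, the event is certain, so its probability 1
  is within the tolerance only for \<open>\<theta>hat j = 1\<close>. The sufficient condition does
  not rule this out; it then holds, for instance, when every \<open>\<iota> i j\<close> is 1. For a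
  strictly larger sum Markov's inequality applies.\<close>

theorem theorem1:
  fixes M :: "'a measure"
    and w :: "'v::finite \<Rightarrow> 'v \<Rightarrow> real"
    and \<pi> \<theta>hat :: "'v \<Rightarrow> real"
    and \<phi> \<theta>tilde :: "'u::finite \<Rightarrow> real"
    and b :: "'u \<Rightarrow> 'v"
    and P :: "'u \<Rightarrow> real ^ 'v ^ 'v"
    and \<gamma> :: "'u \<Rightarrow> real ^ 'v"
    and \<psi> \<iota> :: "'u \<Rightarrow> 'v \<Rightarrow> real"
    and X :: "'u \<Rightarrow> nat \<Rightarrow> 'a \<Rightarrow> 'v"
    and I :: "'u \<Rightarrow> 'v \<Rightarrow> 'a \<Rightarrow> bool"
    and J :: "'u \<Rightarrow> nat \<Rightarrow> 'a \<Rightarrow> bool"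
  assumes "prob_space M"
    and "CARD('u) < CARD('v)"
    and "\<And>j k. 0 < w j k"
    and "\<And>j. 0 < \<pi> j"
    and "\<And>j. 0 < \<theta>hat j \<and> \<theta>hat j \<le> 1"
    and "\<And>i. 0 < \<phi> i"
    and "\<And>i. 0 < \<theta>tilde i \<and> \<theta>tilde i \<le> 1"
    and "\<And>i j. 0 < \<psi> i j"
    and "\<And>i j. 0 < \<iota> i j \<and> \<iota> i j \<le> 1"
    and "\<And>i. ergodic_matrix (P i)"
    and "\<And>i. stationary_distribution (\<gamma> i) (P i)"
    and "\<And>i. markov_chain M (X i) (P i) (b i)"
    and "independent_bernoulli M I \<iota>"
    and "visit_indicators M X \<iota> J"
    and "\<And>j. (\<Sum>i\<in>UNIV. \<gamma> i $ j) \<ge> \<pi> j"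
  shows
    "((\<forall>j. (\<Sum>i\<in>UNIV. \<gamma> i $ j * \<iota> i j)
          \<ge> \<theta>hat j * \<pi> j + (1 - \<theta>hat j) * (\<Sum>i\<in>UNIV. \<gamma> i $ j)) \<longrightarrow>
      (\<forall>j. ((\<Sum>i\<in>UNIV. \<gamma> i $ j) = \<pi> j \<longrightarrow> \<theta>hat j = 1) \<longrightarrow>
         \<P>(\<omega> in M. (\<Sum>i\<in>UNIV. \<gamma> i $ j * of_bool (I i j \<omega>)) \<le> \<pi> j) \<le> \<theta>hat j))
     \<and>
     ((\<forall>i. (\<Sum>j\<in>UNIV. \<gamma> i $ j / \<gamma> i $ b i * (\<Sum>k\<in>UNIV. P i $ j $ k * w j k))
            + (\<Sum>j\<in>UNIV. \<gamma> i $ j / \<gamma> i $ b i * \<psi> i j * \<iota> i j) \<le> \<phi> i * \<theta>tilde i) \<longrightarrow>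
      (\<forall>i. \<P>(\<omega> in M.
              (\<Sum>t = 1..return_time (X i) (b i) \<omega>. w (X i t \<omega>) (X i (t + 1) \<omega>))
            + (\<Sum>t = 1..return_time (X i) (b i) \<omega>. \<psi> i (X i t \<omega>) * of_bool (J i t \<omega>))
              \<ge> \<phi> i) \<le> \<theta>tilde i))"
proof (intro conjI impI allI)
  fix j
  assume le: "\<forall>j. (\<Sum>i\<in>UNIV. \<gamma> i $ j * \<iota> i j)
      \<ge> \<theta>hat j * \<pi> j + (1 - \<theta>hat j) * (\<Sum>i\<in>UNIV. \<gamma> i $ j)"
    and eq: "(\<Sum>i\<in>UNIV. \<gamma> i $ j) = \<pi> j \<longrightarrow> \<theta>hat j = 1"
  interpret prob_space M by fact
  show "\<P>(\<omega> in M. (\<Sum>i\<in>UNIV. \<gamma> i $ j * of_bool (I i j \<omega>)) \<le> \<pi> j) \<le> \<theta>hat j"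
  proof (cases "(\<Sum>i\<in>UNIV. \<gamma> i $ j) = \<pi> j")
    case True
    with eq show ?thesis
      by simp
  next
    case False
    have I: "indep_vars (\<lambda>_. count_space UNIV) (\<lambda>(i, j). I i j) UNIV"
      and distr: "distr M (count_space UNIV) (I i j) = measure_pmf (bernoulli_pmf (\<iota> i j))" for i j
      using assms(13) by (auto simp: independent_bernoulli_def)
    show ?thesis
    proof (rule inspection_rate_tail_bound)
      show "I i j \<in> M \<rightarrow>\<^sub>M count_space UNIV" for i
        using I by (auto simp: indep_vars_def)
      show "0 \<le> \<gamma> i $ j" for i
        using assms(11)[of i] by (simp add: stationary_distribution_def)
      show "\<pi> j < (\<Sum>i\<in>UNIV. \<gamma> i $ j)"
        using False assms(15)[of j] by linarith
      show "0 \<le> \<iota> i j \<and> \<iota> i j \<le> 1" for i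
        using assms(9)[of i j] by simp
    qed (use assms(1) distr le in auto)
  qed
next
  fix i
  let ?e = "(\<Sum>j\<in>UNIV. \<gamma> i $ j / \<gamma> i $ b i * (\<Sum>k\<in>UNIV. P i $ j $ k * w j k))
            + (\<Sum>j\<in>UNIV. \<gamma> i $ j / \<gamma> i $ b i * \<psi> i j * \<iota> i j)"
  assume "\<forall>i. (\<Sum>j\<in>UNIV. \<gamma> i $ j / \<gamma> i $ b i * (\<Sum>k\<in>UNIV. P i $ j $ k * w j k))
            + (\<Sum>j\<in>UNIV. \<gamma> i $ j / \<gamma> i $ b i * \<psi> i j * \<iota> i j) \<le> \<phi> i * \<theta>tilde i"
  then have le: "?e \<le> \<phi> i * \<theta>tilde i"
    by blast
  have "\<P>(\<omega> in M.
              (\<Sum>t = 1..return_time (X i) (b i) \<omega>. w (X i t \<omega>) (X i (t + 1) \<omega>))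
            + (\<Sum>t = 1..return_time (X i) (b i) \<omega>. \<psi> i (X i t \<omega>) * of_bool (J i t \<omega>))
              \<ge> \<phi> i) \<le> ?e / \<phi> i"
  proof (rule tour_cost_tail_bound)
    show "X i t \<in> M \<rightarrow>\<^sub>M count_space UNIV" for i t
      using assms(12)[of i] by (simp add: markov_chain_def)
  qed (use assms in \<open>auto simp: ergodic_matrix_def intro: less_imp_le\<close>)
  also have "\<dots> \<le> \<theta>tilde i"
    using le assms(6)[of i] by (simp add: divide_le_eq mult.commute)
  finally show "\<P>(\<omega> in M.
              (\<Sum>t = 1..return_time (X i) (b i) \<omega>. w (X i t \<omega>) (X i (t + 1) \<omega>))
            + (\<Sum>t = 1..return_time (X i) (b i) \<omega>. \<psi> i (X i t \<omega>) * of_bool (J i t \<omega>))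
              \<ge> \<phi> i) \<le> \<theta>tilde i" .
qed

end
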